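(* Let $\{w_n\}_{n=0}^{\infty}$ be a sequence with $w_0=0$ and such that, for $n\geq 1$, $w_n$ is given by a rational function of $n$ taking only positive values for $n\geq 1$. Suppose further that the polynomial sequences $\{a_n\}_{n=1}^{\infty}$ and $\{b_n\}_{n=1}^{\infty}$ (that is, $a_n$ and $b_n$ are polynomials in $n$) take only positive values for $n\geq 1$, that $a_n-w_{n-1}(b_n+w_n)\neq 0$ for $n=1,2,3,\ldots$, and that the continued fraction $\mathop{K}_{n=1}^{\infty}a_n/b_n$ converges. Then the Bauer-Muir transform of $\mathop{K}_{n=1}^{\infty}a_n/b_n$ with respect to $\{w_n\}_{n=0}^{\infty}$ converges to the same limit.
   Context: Polynomials and rational functions are taken with real coefficients. For a continued fraction $e_0+\mathop{K}_{n=1}^{\infty}c_n/e_n = e_0+\cfrac{c_1}{e_1+\cfrac{c_2}{e_2+\cdots}}$, the canonical numerators $A_n$ and denominators $B_n$ are given by $A_{-1}=1$, $A_0=e_0$, $B_{-1}=0$, $B_0=1$, and $A_n=e_nA_{n-1}+c_nA_{n-2}$, $B_n=e_nB_{n-1}+c_nB_{n-2}$ for $n\ge1$. The continued fraction converges, with limit $L$, if $\lim_{n\to\infty}A_n/B_n=L$. A continued fraction written without $e_0$ has $e_0=0$. The Bauer-Muir transform of $b_0+\mathop{K}_{n=1}^{\infty}a_n/b_n$ (here $b_0=0$) with respect to $\{w_n\}_{n=0}^{\infty}$ is the continued fraction whose canonical numerators $C_n$ and denominators $D_n$ are $C_{-1}=1$, $D_{-1}=0$, and $C_n=A_n+w_nA_{n-1}$,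 $D_n=B_n+w_nB_{n-1}$ for $n\ge 0$, where $A_n,B_n$ are the canonical numerators and denominators of $b_0+\mathop{K}_{n=1}^{\infty}a_n/b_n$. When $a_n-w_{n-1}(b_n+w_n)\ne0$ for all $n\ge1$ it exists and is $$b_0+w_0+\cfrac{a_1-w_0(b_1+w_1)}{b_1+w_1+\cfrac{c_2}{d_2+\cfrac{c_3}{d_3+\cdots}}},$$ where, for $n\ge2$, $c_n=a_{n-1}\rho_n$ and $d_n=b_n+w_n-w_{n-2}\rho_n$ with $\rho_n=\dfrac{a_n-w_{n-1}(b_n+w_n)}{a_{n-1}-w_{n-2}(b_{n-1}+w_{n-1})}$. *)

theory Defs
  imports Complex_Main "HOL-Computational_Algebra.Polynomial"
begin

text \<open>
  A continued fraction \<open>e\<^sub>0 + K (c\<^sub>n / e\<^sub>n)\<close> is given by two sequences \<open>c\<close> and \<open>e\<close>; the value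
  \<open>c 0\<close> is never used, and \<open>e 0\<close> is the leading term (zero for a continued fraction written
  without one). Indices are shifted by one to accommodate the index \<open>-1\<close>:
  \<open>cf_num c e n\<close> and \<open>cf_den c e n\<close> are the canonical numerator \<open>A\<close> and denominator \<open>B\<close>
  with index \<open>n - 1\<close>.
\<close>

fun cf_num :: "(nat \<Rightarrow> real) \<Rightarrow> (nat \<Rightarrow> real) \<Rightarrow> nat \<Rightarrow> real" where
  "cf_num c e 0 = 1"
| "cf_num c e (Suc 0) = e 0"
| "cf_num c e (Suc (Suc n)) = e (Suc n) * cf_num c e (Suc n) + c (Suc n) * cf_num c e n"

fun cf_den :: "(nat \<Rightarrow> real) \<Rightarrow> (nat \<Rightarrow> real) \<Rightarrow> nat \<Rightarrow> real" where
  "cf_den c e 0 = 0"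
| "cf_den c e (Suc 0) = 1"
| "cf_den c e (Suc (Suc n)) = e (Suc n) * cf_den c e (Suc n) + c (Suc n) * cf_den c e n"

text \<open>
  Since \<open>x / 0 = 0\<close> in HOL, the approximants are required to be genuinely defined from some
  index on.
\<close>

definition cf_converges_to :: "(nat \<Rightarrow> real) \<Rightarrow> (nat \<Rightarrow> real) \<Rightarrow> real \<Rightarrow> bool" where
  "cf_converges_to c e L \<longleftrightarrow>
     (\<forall>\<^sub>F n in sequentially. cf_den c e (Suc n) \<noteq> 0) \<and>
     (\<lambda>n. cf_num c e (Suc n) / cf_den c e (Suc n)) \<longlonglongrightarrow> L"

text \<open>
  \<open>bauer_muir_transform a b w c d\<close>: the continued fraction \<open>d\<^sub>0 + K (c\<^sub>n / d\<^sub>n)\<close> is the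
  Bauer-Muir transform of \<open>b\<^sub>0 + K (a\<^sub>n / b\<^sub>n)\<close> with respect to \<open>w\<close>. The values at index \<open>-1\<close>
  hold by definition of the canonical numerators and denominators.
\<close>

definition bauer_muir_transform ::
  "(nat \<Rightarrow> real) \<Rightarrow> (nat \<Rightarrow> real) \<Rightarrow> (nat \<Rightarrow> real) \<Rightarrow> (nat \<Rightarrow> real) \<Rightarrow> (nat \<Rightarrow> real) \<Rightarrow> bool" where
  "bauer_muir_transform a b w c d \<longleftrightarrow>
     (\<forall>n. cf_num c d (Suc n) = cf_num a b (Suc n) + w n * cf_num a b n \<and>
          cf_den c d (Suc n) = cf_den a b (Suc n) + w n * cf_den a b n)"

definition polynomial_seq :: "(nat \<Rightarrow> real) \<Rightarrow> bool" where
  "polynomial_seq f \<longleftrightarrow> (\<exists>p :: real poly. \<forall>n\<ge>1. f n = poly p (real n))"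

definition rational_seq :: "(nat \<Rightarrow> real) \<Rightarrow> bool" where
  "rational_seq f \<longleftrightarrow>
     (\<exists>p q :: real poly. \<forall>n\<ge>1. poly q (real n) \<noteq> 0 \<and> f n = poly p (real n) / poly q (real n))"

text \<open>
  Explicit coefficients of the Bauer-Muir transform, and the fact that it exists if no
  \<open>bm_lambda a b w n\<close> with \<open>n \<ge> 1\<close> vanishes.
\<close>

definition bm_lambda :: "(nat \<Rightarrow> real) \<Rightarrow> (nat \<Rightarrow> real) \<Rightarrow> (nat \<Rightarrow> real) \<Rightarrow> nat \<Rightarrow> real" where
  "bm_lambda a b w n = a n - w (n - 1) * (b n + w n)"

definition bm_rho :: "(nat \<Rightarrow> real) \<Rightarrow> (nat \<Rightarrow> real) \<Rightarrow> (nat \<Rightarrow> real) \<Rightarrow> nat \<Rightarrow> real" where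
  "bm_rho a b w n = bm_lambda a b w n / bm_lambda a b w (n - 1)"

definition bm_numer :: "(nat \<Rightarrow> real) \<Rightarrow> (nat \<Rightarrow> real) \<Rightarrow> (nat \<Rightarrow> real) \<Rightarrow> nat \<Rightarrow> real" where
  "bm_numer a b w n =
     (if n \<le> 1 then bm_lambda a b w n else a (n - 1) * bm_rho a b w n)"

definition bm_denom :: "(nat \<Rightarrow> real) \<Rightarrow> (nat \<Rightarrow> real) \<Rightarrow> (nat \<Rightarrow> real) \<Rightarrow> nat \<Rightarrow> real" where
  "bm_denom a b w n =
     (if n \<le> 1 then b n + w n else b n + w n - w (n - 2) * bm_rho a b w n)"

lemma bauer_muir_transform_explicit:
  assumes nz: "\<And>n. n \<ge> 1 \<Longrightarrow> bm_lambda a b w n \<noteq> 0"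
  shows "bauer_muir_transform a b w (bm_numer a b w) (bm_denom a b w)"
proof -
  let ?c = "bm_numer a b w" and ?d = "bm_denom a b w"
  have step: "?d (Suc (Suc n)) * (X2 + w (Suc n) * X1) + ?c (Suc (Suc n)) * (X1 + w n * X0)
      = b (Suc (Suc n)) * X2 + a (Suc (Suc n)) * X1 + w (Suc (Suc n)) * X2"
    if X2: "X2 = b (Suc n) * X1 + a (Suc n) * X0" for n X0 X1 X2
  proof -
    define r where "r = bm_rho a b w (Suc (Suc n))"
    have r: "r * (a (Suc n) - w n * (b (Suc n) + w (Suc n)))
        = a (Suc (Suc n)) - w (Suc n) * (b (Suc (Suc n)) + w (Suc (Suc n)))"
      using nz[of "Suc n"] by (simp add: r_def bm_rho_def bm_lambda_def)
    have "?d (Suc (Suc n)) * (X2 + w (Suc n) * X1) + ?c (Suc (Suc n)) * (X1 + w n * X0)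
      = (b (Suc (Suc n)) + w (Suc (Suc n))) * (X2 + w (Suc n) * X1)
        + X1 * (r * (a (Suc n) - w n * (b (Suc n) + w (Suc n))))"
      unfolding X2 by (simp add: bm_numer_def bm_denom_def r_def[symmetric] algebra_simps)
    also have "\<dots> = b (Suc (Suc n)) * X2 + a (Suc (Suc n)) * X1 + w (Suc (Suc n)) * X2"
      unfolding r by (simp add: algebra_simps)
    finally show ?thesis .
  qed
  have "cf_num ?c ?d (Suc n) = cf_num a b (Suc n) + w n * cf_num a b n \<and>
        cf_den ?c ?d (Suc n) = cf_den a b (Suc n) + w n * cf_den a b n" for n
  proof (induction n rule: less_induct)
    case (less n)
    consider "n = 0" | "n = 1" | k where "n = Suc (Suc k)"
      by (metis One_nat_def not0_implies_Suc)
    then show ?case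
    proof cases
      case 1
      then show ?thesis by (simp add: bm_denom_def)
    next
      case 2
      then show ?thesis
        by (simp add: bm_denom_def bm_numer_def bm_lambda_def algebra_simps)
    next
      case 3
      have "k < n" "Suc k < n"
        using 3 by simp_all
      note IH = less.IH[OF this(1)] less.IH[OF this(2)]
      show ?thesis
        unfolding 3 cf_num.simps(3)[of _ _ "Suc k"] cf_den.simps(3)[of _ _ "Suc k"]
        using IH step[OF cf_num.simps(3)[of a b k]] step[OF cf_den.simps(3)[of a b k]]
        by metis
    qed
  qed
  then show ?thesis
    by (simp add: bauer_muir_transform_def)
qed

end

theory Submission
  imports Defs
begin

text \<open>
  Since all \<open>a\<^sub>n\<close> and \<open>b\<^sub>n\<close> with \<open>n \<ge> 1\<close> are positive, so are the canonical denominators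
  \<open>B\<^sub>0, B\<^sub>1, \<dots>\<close>. For \<open>n \<ge> 1\<close> the approximant of the Bauer-Muir transform,
  \<open>(A\<^sub>n + w\<^sub>n A\<^sub>n\<^sub>-\<^sub>1) / (B\<^sub>n + w\<^sub>n B\<^sub>n\<^sub>-\<^sub>1)\<close>, is therefore a weighted mediant of the two
  consecutive approximants \<open>A\<^sub>n / B\<^sub>n\<close> and \<open>A\<^sub>n\<^sub>-\<^sub>1 / B\<^sub>n\<^sub>-\<^sub>1\<close>, with positive weights, and lies
  between them (\<open>weighted_mediant_between\<close>). Both of these tend to \<open>L\<close>, so the transform is
  squeezed to \<open>L\<close> as well.
\<close>

lemma cf_den_pos:
  assumes "\<And>n. n \<ge> 1 \<Longrightarrow> c n > 0" and "\<And>n. n \<ge> 1 \<Longrightarrow> e n > 0"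
  shows "cf_den c e (Suc n) > 0"
proof (induction n rule: less_induct)
  case (less n)
  consider "n = 0" | "n = 1" | k where "n = Suc (Suc k)"
    by (metis One_nat_def not0_implies_Suc)
  then show ?case
  proof cases
    case 3
    then show ?thesis
      using less.IH[of k] less.IH[of "Suc k"] assms by (simp add: add_pos_pos)
  qed (use assms in simp_all)
qed

text \<open>
  The weighted mediant is the convex combination of \<open>p / q\<close> and \<open>r / s\<close> with weights
  proportional to \<open>q\<close> and \<open>w * s\<close>.
\<close>

lemma weighted_mediant_between:
  fixes p q r s w :: real
  assumes "q > 0" "s > 0" "w \<ge> 0"
  shows "min (p / q) (r / s) \<le> (p + w * r) / (q + w * s)"
    and "(p + w * r) / (q + w * s) \<le> max (p / q) (r / s)"
proof -
  have pos: "q + w * s > 0"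
    using assms by (simp add: add_pos_nonneg)
  have eq: "p + w * r = q * (p / q) + (w * s) * (r / s)"
    using assms by simp
  have "min (p / q) (r / s) * (q + w * s) \<le> q * (p / q) + (w * s) * (r / s)"
    unfolding distrib_left mult.commute[of "min _ _"]
    by (intro add_mono mult_left_mono) (use assms in auto)
  then show "min (p / q) (r / s) \<le> (p + w * r) / (q + w * s)"
    using pos eq by (simp add: pos_le_divide_eq)
  have "q * (p / q) + (w * s) * (r / s) \<le> max (p / q) (r / s) * (q + w * s)"
    unfolding distrib_left mult.commute[of "max _ _"]
    by (intro add_mono mult_left_mono) (use assms in auto)
  then show "(p + w * r) / (q + w * s) \<le> max (p / q) (r / s)"
    using pos eq by (simp add: pos_divide_le_eq)
qed

theorem proposition5:
  fixes a b w :: "nat \<Rightarrow> real" and L :: real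
  assumes "w 0 = 0"
    and "rational_seq w" and "\<And>n. n \<ge> 1 \<Longrightarrow> w n > 0"
    and "polynomial_seq a" and "\<And>n. n \<ge> 1 \<Longrightarrow> a n > 0"
    and "polynomial_seq b" and "\<And>n. n \<ge> 1 \<Longrightarrow> b n > 0"
    and "b 0 = 0"
    and "\<And>n. n \<ge> 1 \<Longrightarrow> a n - w (n - 1) * (b n + w n) \<noteq> 0"
    and "cf_converges_to a b L"
  shows "(\<exists>c d. bauer_muir_transform a b w c d) \<and>
         (\<forall>c d. bauer_muir_transform a b w c d \<longrightarrow> cf_converges_to c d L)"
proof (intro conjI allI impI)
  show "\<exists>c d. bauer_muir_transform a b w c d"
    using bauer_muir_transform_explicit[of a b w] assms(9) by (auto simp: bm_lambda_def)
next
  fix c d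
  assume bm: "bauer_muir_transform a b w c d"
  define x where "x n = cf_num a b (Suc n) / cf_den a b (Suc n)" for n
  define z where "z n = cf_num c d (Suc n) / cf_den c d (Suc n)" for n
  have B: "cf_den a b (Suc n) > 0" for n
    using assms(5,7) by (rule cf_den_pos)
  have w: "w (Suc n) > 0" for n
    using assms(3) by simp
  have num: "cf_num c d (Suc n) = cf_num a b (Suc n) + w n * cf_num a b n"
    and den: "cf_den c d (Suc n) = cf_den a b (Suc n) + w n * cf_den a b n" for n
    using bm unfolding bauer_muir_transform_def by blast+
  have D: "cf_den c d (Suc (Suc n)) > 0" for n
    unfolding den[of "Suc n"] using B w by (intro add_pos_pos mult_pos_pos)
  have x: "x \<longlonglongrightarrow> L"
    using assms(10) by (simp add: cf_converges_to_def x_def[abs_def])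
  then have x_Suc: "(\<lambda>n. x (Suc n)) \<longlonglongrightarrow> L"
    by (rule LIMSEQ_Suc)
  \<comment> \<open>The index starts at 1: the denominator \<open>B\<^sub>-\<^sub>1 = 0\<close> occurring in \<open>D\<^sub>0\<close> is not positive.\<close>
  have between: "min (x (Suc n)) (x n) \<le> z (Suc n)" "z (Suc n) \<le> max (x (Suc n)) (x n)" for n
    unfolding x_def z_def num[of "Suc n"] den[of "Suc n"]
    by (intro weighted_mediant_between B less_imp_le[OF w])+
  have "(\<lambda>n. z (Suc n)) \<longlonglongrightarrow> L"
  proof (rule tendsto_sandwich)
    show "\<forall>\<^sub>F n in sequentially. min (x (Suc n)) (x n) \<le> z (Suc n)"
      and "\<forall>\<^sub>F n in sequentially. z (Suc n) \<le> max (x (Suc n)) (x n)"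
      using between by simp_all
    show "(\<lambda>n. min (x (Suc n)) (x n)) \<longlonglongrightarrow> L"
      using tendsto_min[OF x_Suc x] by simp
    show "(\<lambda>n. max (x (Suc n)) (x n)) \<longlonglongrightarrow> L"
      using tendsto_max[OF x_Suc x] by simp
  qed
  then have "z \<longlonglongrightarrow> L"
    by (rule LIMSEQ_imp_Suc)
  moreover have "\<forall>\<^sub>F n in sequentially. cf_den c d (Suc n) \<noteq> 0"
    unfolding eventually_sequentially
  proof (intro exI[of _ 1] allI impI)
    fix n :: nat
    assume "n \<ge> 1"
    then show "cf_den c d (Suc n) \<noteq> 0"
      using D[of "n - 1"] by simp
  qed
  ultimately show "cf_converges_to c d L"
    by (simp add: cf_converges_to_def z_def[abs_def])
qed

end
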